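(* Let $f\colon\mathbb N\to\mathbb C$ and $q\in\mathbb C$ be such that the infinite product $\prod_{n=1}^\infty(1-f(n)q^n)^{-1}$ converges. Write $\varphi_0(f;q):=1$, $\varphi_n(f;q):=\prod_{k=1}^n(1-f(k)q^k)$ for $n\ge1$, and $\varphi_\infty(f;q):=\lim_{n\to\infty}\varphi_n(f;q)$. Let \[\Sigma_5:=\sum_{n=1}^\infty q^n\frac{f(n)}{\varphi_n(f;q)},\qquad \Sigma_6:=\sum_{n=1}^\infty q^nf(n)\varphi_{n-1}(f;q).\] Then $1/\varphi_\infty(f;q)=\prod_{n\ge1}(1-f(n)q^n)^{-1}$ admits the following equivalent expressions: \begin{align*} \frac1{\varphi_\infty(f;q)}&=\sum_{\lambda\in\mathcal P}q^{|\lambda|}\prod_{\lambda_i\in\lambda}f(\lambda_i)\\ &=1+\Sigma_5\\ &=1+\frac{1}{\varphi_\infty(f;q)}\Sigma_6\\ &=1+\sum_{n=1}^\infty\frac{(-1)^n(q^{-1})^{n(n-1)/2}}{\varphi_n\!\left(\tfrac1f;q^{-1}\right)\prod_{k=1}^{n-1}f(k)}\\ &=1+\cfrac{\Sigma_6}{1-\cfrac{\Sigma_5}{1+\cfrac{\Sigma_6}{1-\cfrac{\Sigma_5}{1+\cdots}}}}, \end{align*} where in the first line the sum is over all integer partitions $\lambda$ (including the empty one) and the product is over the parts $\lambda_i$ of $\lambda$ counted with multiplicity, and $\varphi_n(\tfrac1f;q^{-1}):=\prod_{k=1}^n(1-q^{-k}/f(k))$.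
   Context: $\mathcal P$ denotes the set of integer partitions, $|\lambda|$ the sum of the parts of $\lambda$. The empty partition contributes the term $1$ (empty product).
   Formalization: The partition sum is claimed when |f(n)q^n|<1 and the product converges absolutely (as a limit over parts ≤ N if only |f(n)q^n|<1), the q^{-1} series when q and all f(n) are nonzero, and convergence of the continued fraction when |Σ5Σ6|<1 or Σ5Σ6=-1. *)

theory Defs
  imports "HOL-Analysis.Analysis" "HOL-Library.Multiset"
begin

definition phi :: "(nat \<Rightarrow> complex) \<Rightarrow> complex \<Rightarrow> nat \<Rightarrow> complex" where
  "phi f q n = (\<Prod>k=1..n. 1 - f k * q ^ k)"

definition phi_inf :: "(nat \<Rightarrow> complex) \<Rightarrow> complex \<Rightarrow> complex" where
  "phi_inf f q = lim (phi f q)"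

text \<open>Series and products over \<open>n \<ge> 1\<close> are indexed by \<open>Suc n\<close>; the value \<open>f 0\<close> is never used.\<close>

definition sigma5_term :: "(nat \<Rightarrow> complex) \<Rightarrow> complex \<Rightarrow> nat \<Rightarrow> complex" where
  "sigma5_term f q n = q ^ n * (f n / phi f q n)"

definition sigma6_term :: "(nat \<Rightarrow> complex) \<Rightarrow> complex \<Rightarrow> nat \<Rightarrow> complex" where
  "sigma6_term f q n = q ^ n * f n * phi f q (n - 1)"

definition Sigma5 :: "(nat \<Rightarrow> complex) \<Rightarrow> complex \<Rightarrow> complex" where
  "Sigma5 f q = (\<Sum>n. sigma5_term f q (Suc n))"

definition Sigma6 :: "(nat \<Rightarrow> complex) \<Rightarrow> complex \<Rightarrow> complex" where
  "Sigma6 f q = (\<Sum>n. sigma6_term f q (Suc n))"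

definition inverse_base_term :: "(nat \<Rightarrow> complex) \<Rightarrow> complex \<Rightarrow> nat \<Rightarrow> complex" where
  "inverse_base_term f q n =
     (-1) ^ n * inverse q ^ (n * (n - 1) div 2) /
     (phi (\<lambda>k. 1 / f k) (inverse q) n * (\<Prod>k=1..n-1. f k))"

definition partitions :: "nat multiset set" where
  "partitions = {p. 0 \<notin># p}"

definition partition_term :: "(nat \<Rightarrow> complex) \<Rightarrow> complex \<Rightarrow> nat multiset \<Rightarrow> complex" where
  "partition_term f q p = q ^ (\<Sum>\<^sub># p) * (\<Prod>i\<in>#p. f i)"

text \<open>
  A continued fraction \<open>b 0 + a 1 / (b 1 + a 2 / (b 2 + \<dots>))\<close> is given by its partial
  numerators \<open>a\<close> and partial denominators \<open>b\<close>; \<open>a 0\<close> is not used.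
  \<open>cf_eval a b n k t\<close> is the finite fraction
  \<open>b k + a (k+1) / (b (k+1) + \<dots> + a (k+n) / t)\<close> of depth \<open>n\<close>, with tail \<open>t\<close>.
\<close>

fun cf_eval :: "(nat \<Rightarrow> complex) \<Rightarrow> (nat \<Rightarrow> complex) \<Rightarrow> nat \<Rightarrow> nat \<Rightarrow> complex \<Rightarrow> complex" where
  "cf_eval a b 0 k t = t"
| "cf_eval a b (Suc n) k t = b k + a (Suc k) / cf_eval a b n (Suc k) t"

text \<open>
  The convergents are defined by the fundamental (Wallis) recurrences, shifted by one:
  \<open>cf_num a b (Suc n) / cf_den a b (Suc n)\<close> is the \<open>n\<close>-th convergent.
  Evaluating the nested fraction literally with \<open>x / 0 = 0\<close> would give wrong values as soon as an
  inner denominator vanishes, although the convergent may be perfectly well defined (an inner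
  value \<open>\<infinity>\<close>). When no inner denominator vanishes both agree, see \<open>cf_convergent_eq\<close>.
\<close>

fun cf_num :: "(nat \<Rightarrow> complex) \<Rightarrow> (nat \<Rightarrow> complex) \<Rightarrow> nat \<Rightarrow> complex" where
  "cf_num a b 0 = 1"
| "cf_num a b (Suc 0) = b 0"
| "cf_num a b (Suc (Suc n)) = b (Suc n) * cf_num a b (Suc n) + a (Suc n) * cf_num a b n"

fun cf_den :: "(nat \<Rightarrow> complex) \<Rightarrow> (nat \<Rightarrow> complex) \<Rightarrow> nat \<Rightarrow> complex" where
  "cf_den a b 0 = 0"
| "cf_den a b (Suc 0) = 1"
| "cf_den a b (Suc (Suc n)) = b (Suc n) * cf_den a b (Suc n) + a (Suc n) * cf_den a b n"

definition cf_has_value :: "(nat \<Rightarrow> complex) \<Rightarrow> (nat \<Rightarrow> complex) \<Rightarrow> complex \<Rightarrow> bool" where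
  "cf_has_value a b x \<longleftrightarrow>
     (\<forall>\<^sub>F n in sequentially. cf_den a b (Suc n) \<noteq> 0) \<and>
     (\<lambda>n. cf_num a b (Suc n) / cf_den a b (Suc n)) \<longlonglongrightarrow> x"

lemma cf_eval_snoc: "cf_eval a b (Suc n) k t = cf_eval a b n k (b (k + n) + a (Suc (k + n)) / t)"
  by (induction n arbitrary: k) (simp, metis add_Suc add_Suc_right cf_eval.simps(2))

lemma cf_eval_eq:
  assumes "\<And>k. 1 \<le> k \<Longrightarrow> k \<le> Suc n \<Longrightarrow> cf_eval a b (Suc n - k) k t \<noteq> 0"
  shows "cf_eval a b (Suc n) 0 t =
    (t * cf_num a b (Suc n) + a (Suc n) * cf_num a b n) /
    (t * cf_den a b (Suc n) + a (Suc n) * cf_den a b n)"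
  using assms
proof (induction n arbitrary: t)
  case 0
  from 0[of 1] have "t \<noteq> 0" by simp
  then show ?case by (simp add: field_simps)
next
  case (Suc n)
  define s where "s = b (Suc n) + a (Suc (Suc n)) / t"
  have t: "t \<noteq> 0" using Suc.prems[of "Suc (Suc n)"] by simp
  have "cf_eval a b (Suc n - k) k s \<noteq> 0" if "1 \<le> k" "k \<le> Suc n" for k
  proof -
    have "cf_eval a b (Suc (Suc n) - k) k t = cf_eval a b (Suc n - k) k s"
      using that cf_eval_snoc[of a b "Suc n - k" k t] by (simp add: s_def Suc_diff_le)
    then show ?thesis using Suc.prems[of k] that by simp
  qed
  then have IH: "cf_eval a b (Suc n) 0 s =
    (s * cf_num a b (Suc n) + a (Suc n) * cf_num a b n) /
    (s * cf_den a b (Suc n) + a (Suc n) * cf_den a b n)"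
    by (rule Suc.IH)
  have "s * x + a (Suc n) * y =
      (t * (b (Suc n) * x + a (Suc n) * y) + a (Suc (Suc n)) * x) / t" for x y
    using t by (simp add: s_def field_simps)
  then show ?case
    using t IH cf_eval_snoc[of a b "Suc n" 0 t] by (simp add: s_def del: cf_eval.simps)
qed

lemma cf_convergent_eq:
  assumes "\<And>k. 1 \<le> k \<Longrightarrow> k \<le> n \<Longrightarrow> cf_eval a b (n - k) k (b n) \<noteq> 0"
  shows "cf_eval a b n 0 (b n) = cf_num a b (Suc n) / cf_den a b (Suc n)"
proof (cases n)
  case 0
  then show ?thesis by simp
next
  case (Suc m)
  with assms cf_eval_eq[of m a b "b n"] show ?thesis by (simp del: cf_eval.simps)
qed

text \<open>
  Partial numerators of \<open>1 + \<Sigma>6 / (1 - \<Sigma>5 / (1 + \<Sigma>6 / (1 - \<dots>)))\<close>; all partial denominators are 1.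
\<close>

definition sigma_cf_num :: "(nat \<Rightarrow> complex) \<Rightarrow> complex \<Rightarrow> nat \<Rightarrow> complex" where
  "sigma_cf_num f q n = (if odd n then Sigma6 f q else - Sigma5 f q)"

end

(*
  With P = 1 / phi_inf, the terms of Sigma5 and Sigma6 telescope to P - 1 and 1 - 1 / P, and clearing
  the negative powers of q turns the series in 1 / q into Sigma5 term by term. For parts at most N,
  the partition sum is a finite product of geometric series; absolute convergence of the product
  bounds the finite subsums uniformly in N. The continued fraction is periodic; along each parity,
  num - P * den is a multiple of c ^ n for c = - (Sigma5 * Sigma6), and den is an affine function of
  the n-th partial sum of the geometric series in c.
*)
theory Submission
  imports Defs
begin

section \<open>Finite products and the terms of the series\<close>

lemma phi_0 [simp]: "phi f q 0 = 1"
  by (simp add: phi_def)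

lemma phi_Suc: "phi f q (Suc n) = phi f q n * (1 - f (Suc n) * q ^ Suc n)"
  by (simp add: phi_def)

lemma sigma6_term_Suc: "sigma6_term f q (Suc n) = phi f q n - phi f q (Suc n)"
  by (simp add: sigma6_term_def phi_Suc algebra_simps)

lemma sigma5_term_Suc:
  assumes "phi f q (Suc n) \<noteq> 0"
  shows "sigma5_term f q (Suc n) = inverse (phi f q (Suc n)) - inverse (phi f q n)"
  using assms by (simp add: sigma5_term_def phi_Suc field_simps)

text \<open>Multiplying \<open>1 - 1 / (f k * q ^ k)\<close> by \<open>f k * q ^ k\<close> gives
  \<open>-(1 - f k * q ^ k)\<close>; over \<open>k = 1..n\<close> the exponents of \<open>q\<close>
  add up to n(n+1)/2.\<close>

lemma phi_inverse:
  assumes "q \<noteq> 0" "\<And>k. k \<ge> 1 \<Longrightarrow> f k \<noteq> 0"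
  shows "phi (\<lambda>k. 1 / f k) (inverse q) n * (\<Prod>k=1..n. f k) * q ^ (n * (n + 1) div 2)
       = (-1) ^ n * phi f q n"
proof (induction n)
  case (Suc n)
  have e: "Suc n * (Suc n + 1) div 2 = n * (n + 1) div 2 + Suc n"
    by simp
  define z where "z = phi (\<lambda>k. 1 / f k) (inverse q) n * (\<Prod>k=1..n. f k) * q ^ (n * (n + 1) div 2)"
  have f: "f (Suc n) \<noteq> 0"
    using assms by simp
  have "phi (\<lambda>k. 1 / f k) (inverse q) (Suc n) * (\<Prod>k=1..Suc n. f k) * q ^ (Suc n * (Suc n + 1) div 2)
      = z * ((1 - 1 / f (Suc n) * inverse q ^ Suc n) * (f (Suc n) * q ^ Suc n))"
    unfolding e power_add by (simp add: phi_Suc z_def)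
  also have "(1 - 1 / f (Suc n) * inverse q ^ Suc n) * (f (Suc n) * q ^ Suc n)
      = - (1 - f (Suc n) * q ^ Suc n)"
    using f assms(1) by (simp add: power_inverse field_simps)
  also have "z * \<dots> = (-1) ^ Suc n * phi f q (Suc n)"
    using Suc.IH[folded z_def] by (simp add: phi_Suc algebra_simps)
  finally show ?case .
qed simp

text \<open>Compared with \<open>phi_inverse\<close> at \<open>Suc n\<close>, the denominator here
  lacks \<open>f (Suc n) * q ^ Suc n\<close>, which is the numerator of
  \<open>sigma5_term\<close>.\<close>

lemma inverse_base_term_eq_sigma5_term:
  assumes "q \<noteq> 0" "\<And>k. k \<ge> 1 \<Longrightarrow> f k \<noteq> 0"
  shows "inverse_base_term f q (Suc n) = sigma5_term f q (Suc n)"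
proof -
  let ?F = "\<Prod>k=1..n. f k" and ?e = "Suc n * n div 2"
  let ?D = "phi (\<lambda>k. 1 / f k) (inverse q) (Suc n) * ?F"
  have e: "Suc n * (Suc n + 1) div 2 = ?e + Suc n"
    by simp
  have nz: "f (Suc n) \<noteq> 0" "q \<noteq> 0"
    using assms by auto
  have phi: "phi f q (Suc n) = (-1) ^ Suc n * (?D * f (Suc n) * q ^ ?e * q ^ Suc n)"
  proof -
    have *: "(-1) ^ Suc n * phi f q (Suc n) = ?D * f (Suc n) * q ^ ?e * q ^ Suc n"
      using phi_inverse[of q f "Suc n", OF assms] unfolding e power_add by (simp add: mult_ac)
    show ?thesis
      unfolding *[symmetric] by (simp only: left_minus_one_mult_self)
  qed
  have "inverse_base_term f q (Suc n) = (-1) ^ Suc n * inverse q ^ ?e / ?D"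
    by (simp add: inverse_base_term_def)
  \<comment> \<open>If \<open>?D = 0\<close>, then \<open>phi f q (Suc n) = 0\<close> as well, and
    both sides are 0 by \<open>x / 0 = 0\<close>.\<close>
  also have "\<dots> = q ^ Suc n * (f (Suc n) / phi f q (Suc n))"
    unfolding phi using nz by (cases "?D = 0"; cases "even n") (simp_all add: power_inverse divide_simps)
  finally show ?thesis
    by (simp add: sigma5_term_def)
qed

section \<open>Sums over partitions\<close>

lemma partition_term_altdef: "partition_term f q p = (\<Prod>i\<in>#p. f i * q ^ i)"
  by (induction p) (auto simp: partition_term_def power_add mult_ac)

lemma norm_prod_mset: "norm (\<Prod>i\<in>#p. x i :: 'a :: real_normed_field) = (\<Prod>i\<in>#p. norm (x i))"
  by (induction p) (auto simp: norm_mult)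

abbreviation (input) partitions_upto :: "nat \<Rightarrow> nat multiset set" where
  "partitions_upto N \<equiv> {p \<in> partitions. set_mset p \<subseteq> {1..N}}"

lemma partitions_upto_0: "partitions_upto 0 = {{#}}"
  by (auto simp: partitions_def)

text \<open>Splitting off the multiplicity \<open>k\<close> of the largest admissible part makes a
  sum over partitions iterated, with a geometric series in \<open>k\<close> inside.\<close>

lemma partitions_upto_Suc_bij:
  "bij_betw (\<lambda>(p, k). p + replicate_mset k (Suc N)) (partitions_upto N \<times> UNIV) (partitions_upto (Suc N))"
proof (rule bij_betw_byWitness[where f' = "\<lambda>p. (filter_mset (\<lambda>i. i \<noteq> Suc N) p, count p (Suc N))"])
  show "\<forall>a\<in>partitions_upto N \<times> UNIV.
      (\<lambda>p. (filter_mset (\<lambda>i. i \<noteq> Suc N) p, count p (Suc N)))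
        ((\<lambda>(p, k). p + replicate_mset k (Suc N)) a) = a"
  proof -
    have "filter_mset (\<lambda>i. i \<noteq> Suc N) p = p \<and> count p (Suc N) = 0" if "set_mset p \<subseteq> {1..N}" for p
      using that by (auto simp: filter_mset_eq_conv count_eq_zero_iff)
    moreover have "filter_mset (\<lambda>i. i \<noteq> Suc N) (replicate_mset k (Suc N)) = {#}" for k
      by (simp add: filter_mset_eq_conv)
    ultimately show ?thesis
      by auto
  qed
  show "\<forall>a'\<in>partitions_upto (Suc N). (\<lambda>(p, k). p + replicate_mset k (Suc N))
      (filter_mset (\<lambda>i. i \<noteq> Suc N) a', count a' (Suc N)) = a'"
    by (auto simp: multiset_eq_iff)
  show "(\<lambda>(p, k). p + replicate_mset k (Suc N)) ` (partitions_upto N \<times> UNIV) \<subseteq> partitions_upto (Suc N)"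
    by (force simp: partitions_def split: if_splits)
  show "(\<lambda>p. (filter_mset (\<lambda>i. i \<noteq> Suc N) p, count p (Suc N))) ` partitions_upto (Suc N)
      \<subseteq> partitions_upto N \<times> UNIV"
    by (fastforce simp: partitions_def le_Suc_eq)
qed

lemma finite_partitions_subset_upto:
  assumes "finite F" "F \<subseteq> partitions"
  obtains N where "F \<subseteq> partitions_upto N"
proof
  have "finite (\<Union> (set_mset ` F))"
    using assms by auto
  \<comment> \<open>\<open>Max\<close> of the empty set is unspecified, but then \<open>F\<close>
    contains at most the empty partition, which lies in every
    \<open>partitions_upto N\<close>.\<close>
  then show "F \<subseteq> partitions_upto (Max (\<Union> (set_mset ` F)))"
    using assms(2) by (force simp: partitions_def Suc_le_eq intro!: Max_ge gr0I)
qed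

lemma has_sum_geometric:
  fixes z :: "'a :: {real_normed_field, banach}"
  assumes "norm z < 1"
  shows "((\<lambda>k. z ^ k) has_sum inverse (1 - z)) UNIV"
  using assms
  by (intro norm_summable_imp_has_sum) (auto simp: norm_power inverse_eq_divide geometric_sums)

text \<open>Norms are nonnegative, so it suffices to sum first over the multiplicity of
  \<open>Suc N\<close>, a geometric series, and then over the smaller partitions.\<close>

lemma partitions_upto_abs_summable:
  fixes x :: "nat \<Rightarrow> 'a :: {real_normed_field, banach}"
  assumes "\<And>n. n \<ge> 1 \<Longrightarrow> norm (x n) < 1"
  shows "(\<lambda>p. \<Prod>i\<in>#p. x i) abs_summable_on partitions_upto N"
proof (induction N)
  case (Suc N)
  have "(\<lambda>(p, k). norm (\<Prod>i\<in>#p. x i) * norm (x (Suc N)) ^ k) summable_on (partitions_upto N \<times> UNIV)"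
  proof (rule summable_on_SigmaI)
    show "((\<lambda>k. case (p, k) of (p, k) \<Rightarrow> norm (\<Prod>i\<in>#p. x i) * norm (x (Suc N)) ^ k) has_sum
        norm (\<Prod>i\<in>#p. x i) * inverse (1 - norm (x (Suc N)))) UNIV" for p
      using assms by (auto intro!: has_sum_cmult_right has_sum_geometric)
  qed (use Suc.IH in \<open>auto intro: summable_on_cmult_left\<close>)
  then show ?case
    by (subst summable_on_reindex_bij_betw[OF partitions_upto_Suc_bij, symmetric])
      (simp add: case_prod_unfold norm_mult norm_power)
qed (simp add: partitions_upto_0)

text \<open>Euler's product for bounded parts; the sum over pairs may be iterated because absolute
  summability is already known.\<close>

lemma partitions_upto_has_sum:
  fixes x :: "nat \<Rightarrow> 'a :: {real_normed_field, banach}"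
  assumes "\<And>n. n \<ge> 1 \<Longrightarrow> norm (x n) < 1"
  shows "((\<lambda>p. \<Prod>i\<in>#p. x i) has_sum (\<Prod>k=1..N. inverse (1 - x k))) (partitions_upto N)"
proof (induction N)
  case (Suc N)
  have "((\<lambda>(p, k). (\<Prod>i\<in>#p. x i) * x (Suc N) ^ k) has_sum
      ((\<Prod>k=1..N. inverse (1 - x k)) * inverse (1 - x (Suc N)))) (partitions_upto N \<times> UNIV)"
  proof (rule has_sum_SigmaI)
    show "((\<lambda>k. case (p, k) of (p, k) \<Rightarrow> (\<Prod>i\<in>#p. x i) * x (Suc N) ^ k) has_sum
        (\<Prod>i\<in>#p. x i) * inverse (1 - x (Suc N))) UNIV" for p
      using assms by (auto intro!: has_sum_cmult_right has_sum_geometric)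
    show "((\<lambda>p. (\<Prod>i\<in>#p. x i) * inverse (1 - x (Suc N))) has_sum
        (\<Prod>k=1..N. inverse (1 - x k)) * inverse (1 - x (Suc N))) (partitions_upto N)"
      by (intro has_sum_cmult_left Suc.IH)
    have "(\<lambda>p. \<Prod>i\<in>#p. x i) summable_on partitions_upto (Suc N)"
      by (rule abs_summable_summable) (rule partitions_upto_abs_summable[OF assms])
    then show "(\<lambda>(p, k). (\<Prod>i\<in>#p. x i) * x (Suc N) ^ k) summable_on partitions_upto N \<times> UNIV"
      by (subst (asm) summable_on_reindex_bij_betw[OF partitions_upto_Suc_bij, symmetric])
        (simp add: case_prod_unfold)
  qed
  then show ?case
    by (subst has_sum_reindex_bij_betw[OF partitions_upto_Suc_bij, symmetric])
      (simp add: case_prod_unfold)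
qed (simp only: partitions_upto_0, simp add: has_sum_finiteI)

text \<open>Every finite set of partitions lies in some \<open>partitions_upto N\<close>, so an
  unconditional sum can be computed along this exhaustion.\<close>

lemma partitions_upto_sum_tendsto:
  fixes g :: "nat multiset \<Rightarrow> 'a :: real_normed_vector"
  assumes "(g has_sum L) partitions" "\<And>N. (g has_sum s N) (partitions_upto N)"
  shows "s \<longlonglongrightarrow> L"
proof (rule tendstoI)
  fix e :: real assume e: "e > 0"
  from assms(1) have "\<forall>\<^sub>F F in finite_subsets_at_top partitions. dist (sum g F) L < e / 2"
    using e unfolding has_sum_def by (intro tendstoD) auto
  then obtain F0 where F0: "finite F0 \<and> F0 \<subseteq> partitions \<and>
      (\<forall>F. finite F \<and> F0 \<subseteq> F \<and> F \<subseteq> partitions \<longrightarrow> dist (sum g F) L < e / 2)"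
    unfolding eventually_finite_subsets_at_top by (rule exE)
  obtain N0 where N0: "F0 \<subseteq> partitions_upto N0"
    using F0 finite_partitions_subset_upto by blast
  have "dist (s N) L < e" if "N \<ge> N0" for N
  proof -
    have sub: "F0 \<subseteq> partitions_upto N"
      using N0 that by fastforce
    \<comment> \<open>Finite sets between \<open>F0\<close> and \<open>partitions_upto N\<close>
      have sums within \<open>e / 2\<close> of \<open>L\<close>; the limit over them keeps only a
      weak inequality, hence the halving.\<close>
    have "dist (s N) L \<le> e / 2"
    proof (rule tendsto_upperbound)
      show "((\<lambda>F. dist (sum g F) L) \<longlongrightarrow> dist (s N) L) (finite_subsets_at_top (partitions_upto N))"
        using assms(2)[of N] unfolding has_sum_def by (intro tendsto_intros)
      show "\<forall>\<^sub>F F in finite_subsets_at_top (partitions_upto N). dist (sum g F) L \<le> e / 2"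
        unfolding eventually_finite_subsets_at_top
      proof (intro exI[of _ F0] conjI allI impI)
        fix F assume F: "finite F \<and> F0 \<subseteq> F \<and> F \<subseteq> partitions_upto N"
        then have "F \<subseteq> partitions" by blast
        with F show "dist (sum g F) L \<le> e / 2"
          using F0 by (simp add: less_imp_le)
      qed (use F0 sub in auto)
    qed simp
    with e show ?thesis by simp
  qed
  then show "\<forall>\<^sub>F N in sequentially. dist (s N) L < e"
    by (auto simp: eventually_sequentially)
qed

lemma partitions_abs_summable:
  fixes x :: "nat \<Rightarrow> 'a :: {real_normed_field, banach}"
  assumes less_1: "\<And>n. n \<ge> 1 \<Longrightarrow> norm (x n) < 1"
    and acp: "abs_convergent_prod (\<lambda>n. inverse (1 - x (Suc n)))"
  shows "(\<lambda>p. \<Prod>i\<in>#p. x i) abs_summable_on partitions"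
proof -
  \<comment> \<open>With \<open>z = x (Suc n)\<close>, \<open>1 / (1 - z) - 1 = z / (1 - z)\<close>,
    and the denominator has norm at most 2.\<close>
  have norm_le: "norm (x (Suc n)) \<le> 2 * norm (inverse (1 - x (Suc n)) - 1)" for n
  proof -
    let ?z = "x (Suc n)"
    have lt: "norm ?z < 1" using less_1 by simp
    then have nz: "1 - ?z \<noteq> 0" by auto
    have "norm (1 - ?z) \<le> 2"
      using norm_triangle_ineq4[of 1 ?z] lt by simp
    moreover have "inverse (1 - ?z) - 1 = ?z / (1 - ?z)"
      using nz by (simp add: field_simps)
    then have "norm (inverse (1 - ?z) - 1) = norm ?z / norm (1 - ?z)"
      by (simp add: norm_divide)
    ultimately show ?thesis
      using nz mult_left_mono[of "norm (1 - ?z)" 2 "norm ?z"] by (simp add: pos_le_divide_eq mult.commute)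
  qed
  have sx: "summable (\<lambda>n. norm (x (Suc n)))"
    using norm_le
    by (intro summable_comparison_test'[OF summable_mult[OF abs_convergent_prod_imp_summable[OF acp]]]) auto
  define y where "y n = inverse (1 - norm (x (Suc n)))" for n
  have y1: "y n \<ge> 1" for n
    using less_1[of "Suc n"] by (simp add: y_def one_le_inverse_iff)
  \<comment> \<open>For \<open>t < 1 / 2\<close>, \<open>t / (1 - t) \<le> 2 * t\<close>; with
    \<open>t = norm (x (Suc n))\<close> the left side is \<open>y n - 1\<close>.\<close>
  have "\<forall>\<^sub>F n in sequentially. norm (x (Suc n)) < 1 / 2"
    by (rule order_tendstoD[OF summable_LIMSEQ_zero[OF sx]]) simp
  then have "\<forall>\<^sub>F n in sequentially. norm (norm (y n - 1)) \<le> 2 * norm (x (Suc n))"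
  proof eventually_elim
    case (elim n)
    have "norm (x (Suc n)) * norm (x (Suc n)) \<le> 1 / 2 * norm (x (Suc n))"
      using elim by (intro mult_right_mono) auto
    with elim y1[of n] show ?case
      by (simp add: y_def field_simps)
  qed
  then have "summable (\<lambda>n. norm (y n - 1))"
    by (rule summable_comparison_test_ev[OF _ summable_mult[OF sx]])
  then have y: "convergent_prod y"
    by (intro abs_convergent_prod_imp_convergent_prod summable_imp_abs_convergent_prod)
  \<comment> \<open>All factors are at least 1, so the partial products increase and the infinite
    product bounds them uniformly in \<open>N\<close>.\<close>
  have bound: "(\<Prod>k=1..N. inverse (1 - norm (x k))) \<le> prodinf y" for N
  proof -
    have "(\<Prod>k=1..N. inverse (1 - norm (x k))) = prod y {..<N}"
      by (simp add: y_def prod.atLeast1_atMost_eq)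
    also have "\<dots> \<le> prodinf y"
      using y y1 by (intro prod_le_prodinf[OF convergent_prod_has_prod]) (auto intro: order.trans[OF zero_le_one])
    finally show ?thesis .
  qed
  show ?thesis
  proof (rule nonneg_bdd_above_summable_on)
    show "bdd_above (sum (\<lambda>p. norm (\<Prod>i\<in>#p. x i)) ` {F. F \<subseteq> partitions \<and> finite F})"
    proof (rule bdd_aboveI2)
      fix F assume "F \<in> {F. F \<subseteq> partitions \<and> finite F}"
      then obtain N where N: "F \<subseteq> partitions_upto N" "finite F"
        using finite_partitions_subset_upto by blast
      have "((\<lambda>p. norm (\<Prod>i\<in>#p. x i)) has_sum (\<Prod>k=1..N. inverse (1 - norm (x k)))) (partitions_upto N)"
        using partitions_upto_has_sum[of "\<lambda>n. norm (x n)" N] less_1 by (simp add: norm_prod_mset)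
      then have "(\<Sum>p\<in>F. norm (\<Prod>i\<in>#p. x i)) \<le> (\<Prod>k=1..N. inverse (1 - norm (x k)))"
        using N by (intro finite_sum_le_has_sum) auto
      with bound[of N] show "(\<Sum>p\<in>F. norm (\<Prod>i\<in>#p. x i)) \<le> prodinf y"
        by linarith
    qed
  qed simp
qed

section \<open>The two-periodic continued fraction with fixed point P\<close>

text \<open>For \<open>P = 1 / phi_inf f q\<close> the two values are \<open>Sigma6\<close> and
  \<open>-Sigma5\<close>: the partial numerators expressed through the intended value alone.\<close>

definition fixpoint_cf :: "complex \<Rightarrow> nat \<Rightarrow> complex" where
  "fixpoint_cf P n = (if odd n then 1 - 1 / P else 1 - P)"

text \<open>
  The linear fractional transformation of one period fixes \<open>P\<close> with the multiplier below:
  attracting if its norm is less than 1, parabolic if it equals 1.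
\<close>

definition fixpoint_multiplier :: "complex \<Rightarrow> complex" where
  "fixpoint_multiplier P = - ((P - 1) * (1 - 1 / P))"

text \<open>\<open>1 + (1 - 1 / P) / t\<close> equals \<open>P\<close> at \<open>t = 1 / P\<close>,
  and \<open>1 + (1 - P) / t\<close> equals \<open>1 / P\<close> at \<open>t = P\<close>, so the
  right tail alternates with the depth.\<close>

lemma fixpoint_cf_eval:
  assumes "P \<noteq> 0"
  shows "cf_eval (fixpoint_cf P) (\<lambda>_. 1) m 0 (if even m then P else 1 / P) = P"
proof (induction m)
  case (Suc m)
  have "1 + fixpoint_cf P (Suc m) / (if even (Suc m) then P else 1 / P) = (if even m then P else 1 / P)"
    using assms by (simp add: fixpoint_cf_def field_simps)
  with Suc.IH show ?case
    by (simp only: cf_eval_snoc add_0)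
qed simp

text \<open>The multiplier is the product of the two partial numerators and also their sum, the form
  in which the two-step recurrence produces it.\<close>

lemma fixpoint_multiplier_eq: "P \<noteq> 0 \<Longrightarrow> fixpoint_multiplier P = (1 - 1 / P) + (1 - P)"
  by (simp add: fixpoint_multiplier_def field_simps)

lemma fixpoint_mult_multiplier: "P \<noteq> 0 \<Longrightarrow> P * fixpoint_multiplier P = - ((P - 1) ^ 2)"
  by (simp add: fixpoint_multiplier_def field_simps power2_eq_square)

text \<open>Numerators and denominators obey the same linear recurrence, hence so does
  \<open>X\<close>. It starts with \<open>1\<close> and \<open>1 - P\<close>, and each period
  multiplies it by the multiplier.\<close>

lemma fixpoint_cf_num_minus_den:
  assumes "P \<noteq> 0"
  defines "X \<equiv> \<lambda>k. cf_num (fixpoint_cf P) (\<lambda>_. 1) k - P * cf_den (fixpoint_cf P) (\<lambda>_. 1) k"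
  shows "X (2 * n) = fixpoint_multiplier P ^ n \<and> X (Suc (2 * n)) = (1 - P) * fixpoint_multiplier P ^ n"
proof (induction n)
  case (Suc n)
  let ?c = "fixpoint_multiplier P"
  have "X (2 * Suc n) = X (Suc (2 * n)) + (1 - 1 / P) * X (2 * n)"
    by (simp add: X_def fixpoint_cf_def algebra_simps)
  also have "\<dots> = ((1 - 1 / P) + (1 - P)) * ?c ^ n"
    unfolding conjunct1[OF Suc.IH] conjunct2[OF Suc.IH] by (simp only: distrib_right add.commute)
  finally have even: "X (2 * Suc n) = ?c ^ Suc n"
    by (simp only: fixpoint_multiplier_eq[OF assms(1), symmetric] power_Suc)
  have "X (Suc (2 * Suc n)) = X (2 * Suc n) + (1 - P) * X (Suc (2 * n))"
    by (simp add: X_def fixpoint_cf_def algebra_simps)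
  also have "\<dots> = (?c + (P - 1) ^ 2) * ?c ^ n"
    unfolding even conjunct2[OF Suc.IH] by (simp add: algebra_simps power2_eq_square)
  also have "?c + (P - 1) ^ 2 = (1 - P) * ?c"
    using fixpoint_mult_multiplier[OF assms(1)] by (simp add: algebra_simps)
  finally show ?case
    using even by simp
qed (simp add: X_def)

text \<open>The even denominators start at 0, and a period takes \<open>s\<close> to
  \<open>1 + c * s\<close> with \<open>c\<close> the multiplier: the recursion of geometric partial
  sums.\<close>

lemma fixpoint_cf_den:
  assumes "P \<noteq> 0"
  defines "d \<equiv> cf_den (fixpoint_cf P) (\<lambda>_. 1)"
  defines "S \<equiv> \<lambda>n. \<Sum>j<n. fixpoint_multiplier P ^ j"
  shows "d (2 * n) = S n \<and> d (Suc (2 * n)) = 1 - (P - 1) * S n"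
proof (induction n)
  case (Suc n)
  let ?c = "fixpoint_multiplier P"
  have S: "S (Suc n) = 1 + ?c * S n"
    by (simp add: S_def sum.lessThan_Suc_shift sum_distrib_left del: sum.lessThan_Suc)
  have "d (2 * Suc n) = d (Suc (2 * n)) + (1 - 1 / P) * d (2 * n)"
    by (simp add: d_def fixpoint_cf_def)
  also have "\<dots> = 1 + ((1 - 1 / P) + (1 - P)) * S n"
    unfolding conjunct1[OF Suc.IH] conjunct2[OF Suc.IH] by (simp add: algebra_simps)
  finally have even: "d (2 * Suc n) = 1 + ?c * S n"
    by (simp only: fixpoint_multiplier_eq[OF assms(1), symmetric])
  have "d (Suc (2 * Suc n)) = d (2 * Suc n) + (1 - P) * d (Suc (2 * n))"
    by (simp add: d_def fixpoint_cf_def)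
  also have "\<dots> = 1 - (P - 1) + (?c + (P - 1) ^ 2) * S n"
    unfolding even conjunct2[OF Suc.IH] by (simp add: algebra_simps power2_eq_square)
  also have "?c + (P - 1) ^ 2 = - (P - 1) * ?c"
    using fixpoint_mult_multiplier[OF assms(1)] by (simp add: algebra_simps)
  finally have odd: "d (Suc (2 * Suc n)) = 1 - (P - 1) + - (P - 1) * ?c * S n" .
  show ?case
    unfolding S even odd by (simp add: algebra_simps)
qed (simp_all add: S_def d_def)

text \<open>Up to constant factors the quotients are the errors of the convergents. If
  \<open>norm c < 1\<close>, the denominators have nonzero limits while \<open>c ^ n\<close> tends
  to 0; if \<open>c = 1\<close>, they grow linearly while \<open>c ^ n\<close> stays 1.\<close>

lemma fixpoint_cf_error:
  assumes "P \<noteq> 0" and c: "norm c < 1 \<or> c = 1" and c_def: "c = fixpoint_multiplier P"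
  defines "S \<equiv> (\<lambda>n. \<Sum>j<n. c ^ j)"
  shows "((\<forall>\<^sub>F n in sequentially. S n \<noteq> 0) \<and> (\<lambda>n. c ^ n / S n) \<longlonglongrightarrow> 0) \<and>
    (\<forall>\<^sub>F n in sequentially. 1 - (P - 1) * S n \<noteq> 0) \<and> (\<lambda>n. c ^ n / (1 - (P - 1) * S n)) \<longlonglongrightarrow> 0"
proof -
  have attracting: "(\<forall>\<^sub>F n in sequentially. d n \<noteq> 0) \<and> (\<lambda>n. c ^ n / d n) \<longlonglongrightarrow> 0"
    if "norm c < 1" "d \<longlonglongrightarrow> L" "L \<noteq> 0" for d L
    using that tendsto_divide[OF LIMSEQ_power_zero[OF that(1)] that(2,3)]
    by (auto intro: tendsto_imp_eventually_ne)
  have parabolic: "(\<forall>\<^sub>F n in sequentially. d n \<noteq> 0) \<and> (\<lambda>n. c ^ n / d n) \<longlonglongrightarrow> 0"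
    if "c = 1" "filterlim d at_infinity sequentially" for d
    using that by (auto intro: filterlim_at_infinity_imp_eventually_ne tendsto_divide_0)
  have lim: "S \<longlonglongrightarrow> 1 / (1 - c)" if "norm c < 1"
    using geometric_sums[OF that] by (simp add: sums_def S_def)
  \<comment> \<open>\<open>P = 1\<close> would give multiplier 0, so the coefficient
    \<open>P - 1\<close> does not cancel the growth of \<open>S\<close>.\<close>
  have t0: "P - 1 \<noteq> 0" if "c = 1"
    using that by (auto simp: c_def fixpoint_multiplier_def)
  have inf: "filterlim S at_infinity sequentially" if "c = 1"
    using that tendsto_of_nat by (simp add: S_def)
  have S: "(\<forall>\<^sub>F n in sequentially. S n \<noteq> 0) \<and> (\<lambda>n. c ^ n / S n) \<longlonglongrightarrow> 0"
  proof (cases "c = 1")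
    case True
    then show ?thesis by (intro parabolic inf)
  next
    case False
    then show ?thesis using c by (intro attracting[OF _ lim]) auto
  qed
  \<comment> \<open>Over the denominator \<open>1 - c\<close> the numerator is
    \<open>1 - c - (P - 1)\<close>, which equals \<open>1 / P\<close> because
    \<open>P * c = -((P - 1) ^ 2)\<close>.\<close>
  have "1 - (P - 1) * (1 / (1 - c)) \<noteq> 0" if "norm c < 1"
  proof -
    have "c \<noteq> 1" using that by auto
    moreover have "P * (1 - c - (P - 1)) = 1"
      using fixpoint_mult_multiplier[OF assms(1)]
      by (simp add: c_def algebra_simps power2_eq_square)
    moreover from this have "1 - c - (P - 1) \<noteq> 0" by auto
    moreover have "1 - (P - 1) * (1 / (1 - c)) = (1 - c - (P - 1)) / (1 - c)"
      using \<open>c \<noteq> 1\<close> by (simp add: field_simps)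
    ultimately show ?thesis by simp
  qed
  moreover have "(\<lambda>n. 1 - (P - 1) * S n) \<longlonglongrightarrow> 1 - (P - 1) * (1 / (1 - c))" if "norm c < 1"
    by (intro tendsto_intros lim that)
  moreover have "filterlim (\<lambda>n. 1 - (P - 1) * S n) at_infinity sequentially" if "c = 1"
  proof -
    have "filterlim (\<lambda>n. (1 - P) * S n) at_infinity sequentially"
      using t0[OF that] by (intro tendsto_mult_filterlim_at_infinity[OF tendsto_const _ inf[OF that]]) auto
    then have "filterlim (\<lambda>n. 1 + (1 - P) * S n) at_infinity sequentially"
      by (intro tendsto_add_filterlim_at_infinity[OF tendsto_const])
    then show ?thesis by (simp add: algebra_simps)
  qed
  ultimately have "(\<forall>\<^sub>F n in sequentially. 1 - (P - 1) * S n \<noteq> 0) \<and> (\<lambda>n. c ^ n / (1 - (P - 1) * S n)) \<longlonglongrightarrow> 0"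
    using c attracting[of "\<lambda>n. 1 - (P - 1) * S n"] parabolic[of "\<lambda>n. 1 - (P - 1) * S n"] by blast
  with S show ?thesis by blast
qed

lemma fixpoint_cf_has_value:
  assumes "P \<noteq> 0" and c: "norm (fixpoint_multiplier P) < 1 \<or> fixpoint_multiplier P = 1"
  shows "cf_has_value (fixpoint_cf P) (\<lambda>_. 1) P"
proof -
  define c where "c = fixpoint_multiplier P"
  let ?num = "cf_num (fixpoint_cf P) (\<lambda>_. 1)" and ?den = "cf_den (fixpoint_cf P) (\<lambda>_. 1)"
  \<comment> \<open>Once the denominator is nonzero, the quotient is
    \<open>P + k * c ^ n / ?den (g n)\<close>; \<open>k\<close> will be \<open>1\<close> at even and
    \<open>1 - P\<close> at odd indices.\<close>
  have conv: "(\<forall>\<^sub>F n in sequentially. ?den (g n) \<noteq> 0) \<and> (\<lambda>n. ?num (g n) / ?den (g n)) \<longlonglongrightarrow> P"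
    if "(\<forall>\<^sub>F n in sequentially. ?den (g n) \<noteq> 0) \<and> (\<lambda>n. c ^ n / ?den (g n)) \<longlonglongrightarrow> 0"
      "\<And>n. ?num (g n) - P * ?den (g n) = k * c ^ n" for g k
  proof -
    have "(\<lambda>n. P + k * (c ^ n / ?den (g n))) \<longlonglongrightarrow> P + k * 0"
      using that by (intro tendsto_intros) auto
    moreover have "\<forall>\<^sub>F n in sequentially. P + k * (c ^ n / ?den (g n)) = ?num (g n) / ?den (g n)"
      using conjunct1[OF that(1)]
    proof eventually_elim
      case (elim n)
      then show ?case using that(2)[of n] by (simp add: field_simps)
    qed
    ultimately show ?thesis
      using that(1) by (auto intro: Lim_transform_eventually)
  qed
  have even: "(\<forall>\<^sub>F n in sequentially. ?den (2 * n) \<noteq> 0) \<and> (\<lambda>n. ?num (2 * n) / ?den (2 * n)) \<longlonglongrightarrow> P"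
    by (rule conv[of _ 1])
      (use conjunct1[OF fixpoint_cf_error[OF assms refl]] fixpoint_cf_num_minus_den[OF assms(1)] fixpoint_cf_den[OF assms(1)]
        in \<open>auto simp: c_def\<close>)
  have odd: "(\<forall>\<^sub>F n in sequentially. ?den (Suc (2 * n)) \<noteq> 0)
      \<and> (\<lambda>n. ?num (Suc (2 * n)) / ?den (Suc (2 * n))) \<longlonglongrightarrow> P"
    by (rule conv[of _ "1 - P"])
      (use conjunct2[OF fixpoint_cf_error[OF assms refl]] fixpoint_cf_num_minus_den[OF assms(1)] fixpoint_cf_den[OF assms(1)]
        in \<open>auto simp: c_def\<close>)
  have all: "\<forall>\<^sub>F n in sequentially. Q n"
    if Q: "\<forall>\<^sub>F n in sequentially. Q (2 * n)" "\<forall>\<^sub>F n in sequentially. Q (Suc (2 * n))" for Q :: "nat \<Rightarrow> bool"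
  proof -
    obtain M where M: "\<And>n. n \<ge> M \<Longrightarrow> Q (2 * n) \<and> Q (Suc (2 * n))"
      using eventually_conj[OF Q] unfolding eventually_sequentially by blast
    have "Q n" if "n \<ge> 2 * M" for n
      using M[of "n div 2"] that by (cases "even n") auto
    then show ?thesis by (auto simp: eventually_sequentially)
  qed
  have "\<forall>\<^sub>F n in sequentially. ?den n \<noteq> 0"
    by (rule all) (use even odd in auto)
  moreover have "(\<lambda>n. ?num n / ?den n) \<longlonglongrightarrow> P"
    unfolding tendsto_def
  proof (intro allI impI)
    fix U :: "complex set" assume "open U" "P \<in> U"
    then show "\<forall>\<^sub>F n in sequentially. ?num n / ?den n \<in> U"
      by (intro all[of "\<lambda>n. ?num n / ?den n \<in> U"] topological_tendstoD[OF conjunct2[OF even]]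
          topological_tendstoD[OF conjunct2[OF odd]])
  qed
  \<comment> \<open>The \<open>n\<close>-th convergent sits at index \<open>Suc n\<close> of
    \<open>cf_num\<close> and \<open>cf_den\<close>, hence the shift.\<close>
  ultimately show ?thesis
    unfolding cf_has_value_def
    by (intro conjI LIMSEQ_Suc[of "\<lambda>n. ?num n / ?den n"])
      (simp_all only: eventually_sequentially_Suc[of "\<lambda>n. ?den n \<noteq> 0"])
qed

section \<open>Limits of the products and the resulting identities\<close>

text \<open>\<open>convergent_prod\<close> tolerates finitely many zero factors and
  \<open>inverse 0 = 0\<close>, so a vanishing \<open>1 - f n * q ^ n\<close> has to be excluded
  explicitly.\<close>

definition euler_product_converges :: "(nat \<Rightarrow> complex) \<Rightarrow> complex \<Rightarrow> bool" where
  "euler_product_converges f q \<longleftrightarrow> (\<forall>n\<ge>1. 1 - f n * q ^ n \<noteq> 0) \<and>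
     convergent_prod (\<lambda>n. inverse (1 - f (Suc n) * q ^ Suc n))"

lemma phi_nonzero: "euler_product_converges f q \<Longrightarrow> phi f q n \<noteq> 0"
  by (auto simp: phi_def euler_product_converges_def)

text \<open>The partial products are \<open>inverse (phi f q n)\<close>. A convergent product of
  nonzero factors has a nonzero limit, so the limit can be inverted.\<close>

lemma phi_limits:
  assumes "euler_product_converges f q"
  shows "phi f q \<longlonglongrightarrow> phi_inf f q \<and> phi_inf f q \<noteq> 0
    \<and> (\<lambda>n. inverse (1 - f (Suc n) * q ^ Suc n)) has_prod (1 / phi_inf f q)"
proof -
  let ?g = "\<lambda>n. inverse (1 - f (Suc n) * q ^ Suc n)"
  have factors: "1 - f n * q ^ n \<noteq> 0" if "n \<ge> 1" for n
    using assms that by (simp add: euler_product_converges_def)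
  have convergent: "convergent_prod ?g"
    using assms by (simp add: euler_product_converges_def)
  have P: "prodinf ?g \<noteq> 0"
    by (intro prodinf_nonzero[OF convergent] nonzero_imp_inverse_nonzero factors) simp
  have phi_prod: "inverse (phi f q n) = (\<Prod>i<n. ?g i)" for n
    by (induction n) (simp_all add: phi_Suc)
  have "(\<lambda>n. inverse (phi f q n)) \<longlonglongrightarrow> prodinf ?g"
    using convergent_prod_LIMSEQ[OF convergent]
    unfolding phi_prod LIMSEQ_lessThan_iff_atMost .
  from tendsto_inverse[OF this P] have lim: "phi f q \<longlonglongrightarrow> inverse (prodinf ?g)"
    by simp
  then have phi_inf: "phi_inf f q = inverse (prodinf ?g)"
    unfolding phi_inf_def by (rule limI)
  have "phi f q \<longlonglongrightarrow> phi_inf f q" "phi_inf f q \<noteq> 0"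
    using lim P by (simp_all add: phi_inf)
  moreover have "?g has_prod (1 / phi_inf f q)"
    unfolding phi_inf using convergent_prod_has_prod[OF convergent]
    by (simp only: divide_inverse inverse_inverse_eq mult_1_left)
  ultimately show ?thesis by blast
qed

lemma phi_tendsto: "euler_product_converges f q \<Longrightarrow> phi f q \<longlonglongrightarrow> phi_inf f q"
  using phi_limits by blast

lemma phi_inf_nonzero: "euler_product_converges f q \<Longrightarrow> phi_inf f q \<noteq> 0"
  using phi_limits by blast

lemma inverse_phi_tendsto:
  "euler_product_converges f q \<Longrightarrow> (\<lambda>n. inverse (phi f q n)) \<longlonglongrightarrow> 1 / phi_inf f q"
  using tendsto_inverse[OF phi_tendsto phi_inf_nonzero] by (simp add: inverse_eq_divide)

lemma sigma5_sums:
  assumes "euler_product_converges f q"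
  shows "(\<lambda>n. sigma5_term f q (Suc n)) sums (1 / phi_inf f q - 1)"
  using telescope_sums[OF inverse_phi_tendsto[OF assms]] phi_nonzero[OF assms]
  by (simp add: sigma5_term_Suc)

lemma sigma6_sums:
  assumes "euler_product_converges f q"
  shows "(\<lambda>n. sigma6_term f q (Suc n)) sums (1 - phi_inf f q)"
  using telescope_sums'[OF phi_tendsto[OF assms]] by (simp add: sigma6_term_Suc)

lemma inverse_base_sums:
  assumes "euler_product_converges f q" "q \<noteq> 0" "\<forall>n\<ge>1. f n \<noteq> 0"
  shows "(\<lambda>n. inverse_base_term f q (Suc n)) sums (1 / phi_inf f q - 1)"
  using sigma5_sums assms by (simp add: inverse_base_term_eq_sigma5_term)

lemma Sigma5_eq: "euler_product_converges f q \<Longrightarrow> Sigma5 f q = 1 / phi_inf f q - 1"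
  unfolding Sigma5_def by (rule sums_unique[OF sigma5_sums, symmetric])

lemma Sigma6_eq: "euler_product_converges f q \<Longrightarrow> Sigma6 f q = 1 - phi_inf f q"
  unfolding Sigma6_def by (rule sums_unique[OF sigma6_sums, symmetric])

lemma partition_term_has_sum_upto:
  assumes "\<forall>n\<ge>1. norm (f n * q ^ n) < 1"
  shows "(partition_term f q has_sum inverse (phi f q N)) (partitions_upto N)"
  using partitions_upto_has_sum[of "\<lambda>n. f n * q ^ n" N] assms
  unfolding partition_term_altdef phi_def prod_inversef[symmetric] by (simp add: o_def)

text \<open>Bounding the parts orders the partition sum so that its partial sums are
  \<open>inverse (phi f q N)\<close>; conditional convergence of the product then suffices.\<close>

lemma partition_term_upto_tendsto:
  assumes "euler_product_converges f q" "\<forall>n\<ge>1. norm (f n * q ^ n) < 1"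
  shows "(\<lambda>N. infsum (partition_term f q) (partitions_upto N)) \<longlonglongrightarrow> 1 / phi_inf f q"
  using inverse_phi_tendsto[OF assms(1)] infsumI[OF partition_term_has_sum_upto[OF assms(2)]] by simp

text \<open>Absolute summability provides some value \<open>L\<close>; the exhaustion by bounded
  parts identifies it.\<close>

lemma partition_term_has_sum:
  assumes "euler_product_converges f q" "\<forall>n\<ge>1. norm (f n * q ^ n) < 1"
    and "abs_convergent_prod (\<lambda>n. inverse (1 - f (Suc n) * q ^ Suc n))"
  shows "(partition_term f q has_sum (1 / phi_inf f q)) partitions"
proof -
  have "partition_term f q summable_on partitions"
    unfolding partition_term_altdef
    by (rule abs_summable_summable, rule partitions_abs_summable) (use assms in auto)
  then obtain L where L: "(partition_term f q has_sum L) partitions"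
    by (auto simp: summable_on_def)
  with partitions_upto_sum_tendsto[OF L partition_term_has_sum_upto[OF assms(2)]]
  show ?thesis
    using LIMSEQ_unique[OF inverse_phi_tendsto[OF assms(1)]] by blast
qed

lemma sigma_cf_num_eq:
  assumes "euler_product_converges f q"
  shows "sigma_cf_num f q = fixpoint_cf (1 / phi_inf f q)"
  using assms by (auto simp: Sigma5_eq Sigma6_eq sigma_cf_num_def fixpoint_cf_def)

text \<open>Self-similarity of the fraction: cut at even depth it leaves its own value as tail, at
  odd depth the reciprocal.\<close>

lemma sigma_cf_eval:
  assumes "euler_product_converges f q"
  shows "cf_eval (sigma_cf_num f q) (\<lambda>_. 1) (2 * n) 0 (1 / phi_inf f q) = 1 / phi_inf f q
    \<and> cf_eval (sigma_cf_num f q) (\<lambda>_. 1) (2 * n + 1) 0 (phi_inf f q) = 1 / phi_inf f q"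
  using fixpoint_cf_eval[of "1 / phi_inf f q" "2 * n"] fixpoint_cf_eval[of "1 / phi_inf f q" "2 * n + 1"]
    phi_inf_nonzero[OF assms]
  by (simp add: sigma_cf_num_eq[OF assms] del: cf_eval.simps)

text \<open>The multiplier is \<open>-(Sigma5 f q * Sigma6 f q)\<close>, so the product -1 is the
  parabolic case.\<close>

lemma sigma_cf_has_value:
  assumes "euler_product_converges f q"
    and "norm (Sigma5 f q * Sigma6 f q) < 1 \<or> Sigma5 f q * Sigma6 f q = -1"
  shows "cf_has_value (sigma_cf_num f q) (\<lambda>_. 1) (1 / phi_inf f q)"
proof -
  have m: "fixpoint_multiplier (1 / phi_inf f q) = - (Sigma5 f q * Sigma6 f q)"
    using assms(1) by (simp add: fixpoint_multiplier_def Sigma5_eq Sigma6_eq)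
  show ?thesis
    unfolding sigma_cf_num_eq[OF assms(1)]
    by (rule fixpoint_cf_has_value) (use assms phi_inf_nonzero in \<open>auto simp: m\<close>)
qed

text \<open>The bound \<open>norm (f n * q ^ n) < 1\<close> reflects the partitions with all parts
  equal to \<open>n\<close>, which form a geometric series. Absolute convergence enters because an
  unordered sum of complex numbers converges only absolutely.\<close>

theorem theorem4p1:
  fixes f :: "nat \<Rightarrow> complex" and q :: complex
  assumes factors_defined: "\<And>n. n \<ge> 1 \<Longrightarrow> 1 - f n * q ^ n \<noteq> 0"
    and convergent: "convergent_prod (\<lambda>n. inverse (1 - f (Suc n) * q ^ Suc n))"
  shows
    "phi f q \<longlonglongrightarrow> phi_inf f q
     \<and> (\<lambda>n. inverse (1 - f (Suc n) * q ^ Suc n)) has_prod (1 / phi_inf f q)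
     \<and> ((\<forall>n\<ge>1. norm (f n * q ^ n) < 1) \<longrightarrow>
          (\<forall>N. partition_term f q summable_on {p \<in> partitions. set_mset p \<subseteq> {1..N}})
          \<and> (\<lambda>N. infsum (partition_term f q) {p \<in> partitions. set_mset p \<subseteq> {1..N}})
               \<longlonglongrightarrow> 1 / phi_inf f q)
     \<and> ((\<forall>n\<ge>1. norm (f n * q ^ n) < 1)
          \<and> abs_convergent_prod (\<lambda>n. inverse (1 - f (Suc n) * q ^ Suc n)) \<longrightarrow>
          (partition_term f q has_sum (1 / phi_inf f q)) partitions)
     \<and> summable (\<lambda>n. sigma5_term f q (Suc n))
     \<and> 1 / phi_inf f q = 1 + Sigma5 f q
     \<and> summable (\<lambda>n. sigma6_term f q (Suc n))
     \<and> 1 / phi_inf f q = 1 + 1 / phi_inf f q * Sigma6 f q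
     \<and> (q \<noteq> 0 \<and> (\<forall>n\<ge>1. f n \<noteq> 0) \<longrightarrow>
          summable (\<lambda>n. inverse_base_term f q (Suc n))
          \<and> 1 / phi_inf f q = 1 + (\<Sum>n. inverse_base_term f q (Suc n)))
     \<and> (\<forall>n. 1 / phi_inf f q = cf_eval (sigma_cf_num f q) (\<lambda>_. 1) (2 * n) 0 (1 / phi_inf f q)
            \<and> 1 / phi_inf f q = cf_eval (sigma_cf_num f q) (\<lambda>_. 1) (2 * n + 1) 0 (phi_inf f q))
     \<and> (norm (Sigma5 f q * Sigma6 f q) < 1 \<or> Sigma5 f q * Sigma6 f q = -1 \<longrightarrow>
          cf_has_value (sigma_cf_num f q) (\<lambda>_. 1) (1 / phi_inf f q))"
proof -
  have conv: "euler_product_converges f q"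
    unfolding euler_product_converges_def using assms by blast
  show ?thesis
  proof (intro conjI)
    show "1 / phi_inf f q = 1 + Sigma5 f q"
      by (simp add: Sigma5_eq[OF conv])
    show "1 / phi_inf f q = 1 + 1 / phi_inf f q * Sigma6 f q"
      using phi_inf_nonzero[OF conv] by (simp add: Sigma6_eq[OF conv] field_simps)
    show "q \<noteq> 0 \<and> (\<forall>n\<ge>1. f n \<noteq> 0) \<longrightarrow> summable (\<lambda>n. inverse_base_term f q (Suc n))
        \<and> 1 / phi_inf f q = 1 + (\<Sum>n. inverse_base_term f q (Suc n))"
      using inverse_base_sums[OF conv] by (simp add: sums_iff)
    show "(\<forall>n\<ge>1. norm (f n * q ^ n) < 1) \<longrightarrow>
        (\<forall>N. partition_term f q summable_on partitions_upto N)
        \<and> (\<lambda>N. infsum (partition_term f q) (partitions_upto N)) \<longlonglongrightarrow> 1 / phi_inf f q"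
      using partition_term_has_sum_upto[of f q, THEN has_sum_imp_summable]
        partition_term_upto_tendsto[OF conv] by blast
    show "\<forall>n. 1 / phi_inf f q = cf_eval (sigma_cf_num f q) (\<lambda>_. 1) (2 * n) 0 (1 / phi_inf f q)
        \<and> 1 / phi_inf f q = cf_eval (sigma_cf_num f q) (\<lambda>_. 1) (2 * n + 1) 0 (phi_inf f q)"
      by (simp only: sigma_cf_eval[OF conv]) simp
  qed (use phi_limits[OF conv] sums_summable[OF sigma5_sums[OF conv]]
      sums_summable[OF sigma6_sums[OF conv]] partition_term_has_sum[OF conv]
      sigma_cf_has_value[OF conv] in blast)+
qed

end
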